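(* Let $H$ be a graph that contains a cycle and has no vertex of degree greater than $3$. Then there is no function $f$ with $f(k)=o(k\log k)$ such that the class of $H$-subdivisions has the induced Erdős–Pósa property with bounding function $f$; that is, for every such $f$ there is a graph $G$ with $\tau_H(G)> f(\nu_H(G))$.
   Context: All graphs are finite and simple. A subdivision of $H$ is a graph obtained from $H$ by repeatedly replacing an edge by a path of length $2$ through a new vertex. An induced subdivision of $H$ in $G$ is an induced subgraph of $G$ isomorphic to a subdivision of $H$. $\nu_H(G)$ is the maximum number of pairwise vertex-disjoint induced subdivisions of $H$ in $G$, and $\tau_H(G)$ the minimum size of $X\subseteq V(G)$ such that $G-X$ has no induced subdivision of $H$. A function $f$ is a bounding function for the induced Erdős–Pósa property of $H$-subdivisions if $\tau_H(G)\le f(\nu_H(G))$ for every graph $G$. *)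

theory Defs
  imports Complex_Main "HOL-Library.Landau_Symbols"
begin

type_synonym 'a graph = "'a set \<times> 'a set set"

definition verts :: "'a graph \<Rightarrow> 'a set" where "verts G = fst G"
definition edges :: "'a graph \<Rightarrow> 'a set set" where "edges G = snd G"

definition wf_graph :: "'a graph \<Rightarrow> bool" where
  "wf_graph G \<longleftrightarrow> finite (verts G) \<and>
     (\<forall>e\<in>edges G. \<exists>u v. u \<noteq> v \<and> u \<in> verts G \<and> v \<in> verts G \<and> e = {u, v})"

definition degree :: "'a graph \<Rightarrow> 'a \<Rightarrow> nat" where
  "degree G v = card {e \<in> edges G. v \<in> e}"

definition has_cycle :: "'a graph \<Rightarrow> bool" where
  "has_cycle G \<longleftrightarrow> (\<exists>vs. length vs \<ge> 3 \<and> distinct vs \<and> set vs \<subseteq> verts G \<and>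
     (\<forall>i < length vs. {vs ! i, vs ! ((i + 1) mod length vs)} \<in> edges G))"

definition graph_iso :: "'a graph \<Rightarrow> 'b graph \<Rightarrow> bool" where
  "graph_iso G H \<longleftrightarrow> (\<exists>\<phi>. bij_betw \<phi> (verts G) (verts H) \<and>
     (\<forall>u\<in>verts G. \<forall>v\<in>verts G. {u, v} \<in> edges G \<longleftrightarrow> {\<phi> u, \<phi> v} \<in> edges H))"

inductive subdivision_of :: "'a graph \<Rightarrow> 'b graph \<Rightarrow> bool" for H where
  iso: "wf_graph S \<Longrightarrow> graph_iso H S \<Longrightarrow> subdivision_of H S"
| step: "subdivision_of H S \<Longrightarrow> {u, v} \<in> edges S \<Longrightarrow> u \<noteq> v \<Longrightarrow> w \<notin> verts S \<Longrightarrow>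
     subdivision_of H (verts S \<union> {w}, (edges S - {{u, v}}) \<union> {{u, w}, {w, v}})"

definition induced :: "'b graph \<Rightarrow> 'b set \<Rightarrow> 'b graph" where
  "induced G X = (X, {e \<in> edges G. e \<subseteq> X})"

definition induced_subdiv :: "'a graph \<Rightarrow> 'b graph \<Rightarrow> 'b set \<Rightarrow> bool" where
  "induced_subdiv H G X \<longleftrightarrow> X \<subseteq> verts G \<and> subdivision_of H (induced G X)"

definition nu :: "'a graph \<Rightarrow> 'b graph \<Rightarrow> nat" where
  "nu H G = Max {card \<X> | \<X>. pairwise disjnt \<X> \<and> (\<forall>X\<in>\<X>. induced_subdiv H G X)}"

text \<open>G - X contains an induced subdivision of H iff some Y disjoint from X induces one in G.\<close>
definition tau :: "'a graph \<Rightarrow> 'b graph \<Rightarrow> nat" where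
  "tau H G = Min {card X | X. X \<subseteq> verts G \<and> \<not> (\<exists>Y. Y \<inter> X = {} \<and> induced_subdiv H G Y)}"

end

theory Submission
  imports Defs "HOL-Library.Transitive_Closure_Table" "HOL-Library.Nat_Bijection"
begin

text \<open>
  Take a graph on n vertices with maximum degree at most d, girth at least g, where n is about
  \<open>(d + 1)\<^sup>g\<close>, and at least dn/4 edges; an edge-maximal graph subject to the degree and girth
  conditions has this many edges, since its vertices of degree below d lie in one ball of radius g.
  For d large in terms of H, deleting n/8 vertices leaves a graph so dense that by
  Mader's theorem it still contains a subdivision of H. In the one-subdivision of the graph such a
  subdivision becomes induced, so the covering number is at least n/8. Each subdivision of H
  contains a cycle, hence at least g of the n original vertices, so the packing number k is at
  most n/g and k log k is only O(n).
\<close>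

section \<open>Subdivisions\<close>

text \<open>Two demands pull against each other: a small packing number asks for long cycles, a
  large covering number asks for density that survives deletions. They are compatible because the
  density that forces a subdivision of \<open>H\<close> is a constant depending on \<open>H\<close>
  alone, so the degree bound \<open>d\<close> stays constant while the girth grows. The degree bound
  caps the loss at \<open>d\<close> edges per deleted vertex, so linearly many deletions are
  survived. It also caps balls of radius \<open>g\<close>, which lets \<open>g\<close> be
  logarithmic in \<open>n\<close>; the ratio \<open>n / g\<close> is the source of the logarithm.
  Density produces subgraphs, not induced ones. After the one-subdivision every edge owns a vertex,
  so an unwanted edge between chosen vertices disappears when its midpoint is left out. A deleted
  midpoint costs one edge of the original graph. The hypothesis on \<open>f\<close> controls only
  large \<open>k\<close>; the finitely many small values are beaten by letting \<open>n\<close>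
  grow.\<close>

lemma verts_Pair [simp]: "verts (V, E) = V"
  and edges_Pair [simp]: "edges (V, E) = E"
  by (simp_all add: verts_def edges_def)

lemma wf_graph_finite_edges: "wf_graph G \<Longrightarrow> finite (edges G)"
  by (rule finite_subset[of _ "Pow (verts G)"]) (auto simp: wf_graph_def)

lemma wf_graph_finite_verts: "wf_graph G \<Longrightarrow> finite (verts G)"
  by (simp add: wf_graph_def)

lemma wf_graph_edge_subset: "wf_graph G \<Longrightarrow> e \<in> edges G \<Longrightarrow> e \<subseteq> verts G"
  by (auto simp: wf_graph_def)

lemma wf_graph_edgeE:
  assumes "wf_graph G" "e \<in> edges G"
  obtains u v where "e = {u, v}" "u \<noteq> v" "u \<in> verts G" "v \<in> verts G"
  using assms unfolding wf_graph_def by metis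

lemma wf_graph_edge_other_end:
  assumes "wf_graph G" "e \<in> edges G" "v \<in> e"
  obtains u where "e = {u, v}" "u \<noteq> v" "u \<in> verts G"
  using assms unfolding wf_graph_def by (metis insertE insert_commute singletonD)

lemma wf_graph_subgraph:
  assumes "wf_graph G" "W \<subseteq> verts G" "F \<subseteq> edges G" "\<And>e. e \<in> F \<Longrightarrow> e \<subseteq> W"
  shows "wf_graph (W, F)"
proof -
  have "\<exists>u v. u \<noteq> v \<and> u \<in> W \<and> v \<in> W \<and> e = {u, v}" if "e \<in> F" for e
    using wf_graph_edgeE[OF assms(1), of e] assms(3,4) that
    by (metis insert_subset subsetD)
  then show ?thesis
    using assms(1,2) finite_subset by (auto simp: wf_graph_def)
qed

lemma card_edge:
  assumes "wf_graph G" "e \<in> edges G"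
  shows "card e = 2"
  using assms by (auto elim: wf_graph_edgeE)

lemma handshake:
  assumes "wf_graph G"
  shows "(\<Sum>v\<in>verts G. card {e \<in> edges G. v \<in> e}) = 2 * card (edges G)"
proof (rule sum_multicount)
  show "finite (verts G)"
    using assms by (simp add: wf_graph_def)
  show "finite (edges G)"
    by (rule wf_graph_finite_edges[OF assms])
  show "\<forall>e\<in>edges G. card {v \<in> verts G. v \<in> e} = 2"
  proof
    fix e assume e: "e \<in> edges G"
    then have "{v \<in> verts G. v \<in> e} = e"
      using wf_graph_edge_subset[OF assms] by auto
    then show "card {v \<in> verts G. v \<in> e} = 2"
      using card_edge[OF assms e] by simp
  qed
qed

lemma subdivision_of_wf: "subdivision_of H S \<Longrightarrow> wf_graph S"
proof (induction rule: subdivision_of.induct)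
  case (step S u v w)
  then have "u \<in> verts S" "v \<in> verts S"
    using wf_graph_edge_subset by fastforce+
  then show ?case
    using step unfolding wf_graph_def by (auto; metis)
qed

text \<open>Prepares an induction over the edges of \<open>H\<close>. The vertices \<open>x\<close>
  and \<open>y\<close> represent \<open>a\<close> and \<open>b\<close>: the isomorphism at the start
  fixes them, and later subdivision steps leave them alone.\<close>

lemma subdivision_of_add_edge:
  assumes "subdivision_of (V, E) S" "a \<in> V" "b \<in> V" "a \<noteq> b" "{a, b} \<notin> E"
  shows "\<exists>x y. x \<in> verts S \<and> y \<in> verts S \<and> x \<noteq> y \<and> {x, y} \<notin> edges S \<and>
    subdivision_of (V, insert {a, b} E) (verts S, insert {x, y} (edges S))"
  using assms(1)
proof (induction rule: subdivision_of.induct)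
  case (iso S)
  then obtain \<phi> where \<phi>: "bij_betw \<phi> V (verts S)"
    and ed: "\<And>u v. u \<in> V \<Longrightarrow> v \<in> V \<Longrightarrow> {u, v} \<in> E \<longleftrightarrow> {\<phi> u, \<phi> v} \<in> edges S"
    by (auto simp: graph_iso_def)
  have inj: "\<phi> u = \<phi> v \<longleftrightarrow> u = v" if "u \<in> V" "v \<in> V" for u v
    using \<phi> that by (auto simp: bij_betw_def inj_on_def)
  have mem: "\<phi> a \<in> verts S" "\<phi> b \<in> verts S"
    using \<phi> assms by (auto simp: bij_betw_def)
  have "graph_iso (V, insert {a, b} E) (verts S, insert {\<phi> a, \<phi> b} (edges S))"
    unfolding graph_iso_def
    using \<phi> ed inj assms(2,3) by (auto intro!: exI[of _ \<phi>] simp: doubleton_eq_iff)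
  moreover have "wf_graph (verts S, insert {\<phi> a, \<phi> b} (edges S))"
    using iso(1) mem inj assms(2-4) by (auto simp: wf_graph_def)
  ultimately show ?case
    using mem inj ed assms(2-5) by (blast intro: subdivision_of.iso)
next
  case (step S u v w)
  then obtain x y where xy: "x \<in> verts S" "y \<in> verts S" "x \<noteq> y" "{x, y} \<notin> edges S"
    and sub: "subdivision_of (V, insert {a, b} E) (verts S, insert {x, y} (edges S))"
    by blast
  have "subdivision_of (V, insert {a, b} E)
     (verts S \<union> {w}, (insert {x, y} (edges S) - {{u, v}}) \<union> {{u, w}, {w, v}})"
    using subdivision_of.step[OF sub, of u v w] step by simp
  \<comment> \<open>\<open>{x, y}\<close> is not an edge of \<open>S\<close>, so it differs from the
    edge \<open>{u, v}\<close> being subdivided, and the two operations commute.\<close>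
  moreover have "(insert {x, y} (edges S) - {{u, v}}) \<union> {{u, w}, {w, v}} =
      insert {x, y} ((edges S - {{u, v}}) \<union> {{u, w}, {w, v}})"
    using xy(4) step.hyps(2) by (metis Un_insert_left insert_Diff_if singletonD)
  moreover have "{x, y} \<notin> (edges S - {{u, v}}) \<union> {{u, w}, {w, v}}"
    using xy step.hyps(4) by (auto simp: doubleton_eq_iff)
  ultimately show ?case
    using xy(1-3) by (intro exI[of _ x] exI[of _ y]) simp
qed

fun path_edges :: "'a \<Rightarrow> 'a list \<Rightarrow> 'a \<Rightarrow> 'a set set" where
  "path_edges x [] y = {{x, y}}"
| "path_edges x (p # ps) y = insert {x, p} (path_edges p ps y)"

text \<open>The path grows from \<open>x\<close>: subdividing \<open>{x, y}\<close> at the first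
  interior vertex \<open>p\<close> freezes \<open>{x, p}\<close> in \<open>E\<close> and leaves
  \<open>{p, y}\<close> to be treated the same way.\<close>

lemma subdivision_of_edge_to_path:
  assumes "subdivision_of H (V, insert {x, y} E)" "{x, y} \<notin> E" "x \<noteq> y" "x \<in> V" "y \<in> V"
    and "distinct ps" "set ps \<inter> V = {}"
  shows "subdivision_of H (V \<union> set ps, E \<union> path_edges x ps y)"
  using assms
proof (induction ps arbitrary: V E x)
  case Nil
  then show ?case by simp
next
  case (Cons p ps)
  have p: "p \<notin> V" "p \<notin> set ps"
    using Cons.prems by auto
  have notin: "p \<notin> e" if "e \<in> E" for e
    using wf_graph_edge_subset[OF subdivision_of_wf[OF Cons.prems(1)]] p(1) that by auto
  have "subdivision_of H (V \<union> {p}, (insert {x, y} E - {{x, y}}) \<union> {{x, p}, {p, y}})"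
    using subdivision_of.step[OF Cons.prems(1), of x y p] Cons.prems p by simp
  moreover have "(insert {x, y} E - {{x, y}}) \<union> {{x, p}, {p, y}} = insert {p, y} (insert {x, p} E)"
    using Cons.prems(2) by auto
  ultimately have "subdivision_of H (insert p V, insert {p, y} (insert {x, p} E))"
    by simp
  then have "subdivision_of H (insert p V \<union> set ps, insert {x, p} E \<union> path_edges p ps y)"
    by (rule Cons.IH) (use Cons.prems p notin in \<open>auto simp: doubleton_eq_iff\<close>)
  then show ?case by simp
qed

text \<open>The list in \<open>rtrancl_path\<close> includes the end \<open>y\<close>, whereas
  \<open>path_edges\<close> lists interior vertices only. The extra edge to \<open>z\<close>
  reconciles the two conventions.\<close>

lemma path_edges_subset:
  assumes "rtrancl_path r x xs y" "\<And>u v. r u v \<Longrightarrow> {u, v} \<in> E" "{y, z} \<in> E"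
  shows "path_edges x xs z \<subseteq> E"
  using assms by (induction rule: rtrancl_path.induct) auto

section \<open>Dense graphs contain subdivisions\<close>

text \<open>Only the target of each step is required to lie in \<open>U\<close>; as the walk starts
  in \<open>U\<close>, it never leaves \<open>U\<close>.\<close>

definition connected_in :: "'a set set \<Rightarrow> 'a set \<Rightarrow> bool" where
  "connected_in E U \<longleftrightarrow> (\<forall>x\<in>U. \<forall>y\<in>U. (\<lambda>a b. {a, b} \<in> E \<and> b \<in> U)\<^sup>*\<^sup>* x y)"

definition nbs :: "'a graph \<Rightarrow> 'a set \<Rightarrow> 'a set" where
  "nbs G U = {v \<in> verts G - U. \<exists>u\<in>U. {u, v} \<in> edges G}"

lemma connected_in_mono:
  assumes "connected_in E U" "E \<subseteq> E'"
  shows "connected_in E' U"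
proof -
  have "(\<lambda>a b. {a, b} \<in> E \<and> b \<in> U)\<^sup>*\<^sup>* \<le> (\<lambda>a b. {a, b} \<in> E' \<and> b \<in> U)\<^sup>*\<^sup>*"
    using assms(2) by (intro rtranclp_mono) auto
  then show ?thesis
    using assms(1) by (auto simp: connected_in_def)
qed

lemma connected_in_insert:
  assumes "connected_in E U" "u \<in> U" "{u, v} \<in> E"
  shows "connected_in E (insert v U)"
proof -
  let ?r = "\<lambda>a b. {a, b} \<in> E \<and> b \<in> insert v U"
  have U: "?r\<^sup>*\<^sup>* x y" if "x \<in> U" "y \<in> U" for x y
  proof -
    have "(\<lambda>a b. {a, b} \<in> E \<and> b \<in> U)\<^sup>*\<^sup>* \<le> ?r\<^sup>*\<^sup>*"
      by (intro rtranclp_mono) auto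
    then show ?thesis
      using assms(1) that by (auto simp: connected_in_def)
  qed
  have uv: "?r u v" "?r v u"
    using assms(2,3) by (auto simp: insert_commute)
  have to: "?r\<^sup>*\<^sup>* x u" and from_u: "?r\<^sup>*\<^sup>* u x" if "x \<in> insert v U" for x
    using that U[OF _ assms(2)] U[OF assms(2)] uv by auto
  show ?thesis
    unfolding connected_in_def using to from_u by (meson rtranclp_trans)
qed

text \<open>The number of edges of the simple graph obtained by contracting U to a single vertex.\<close>

definition contracted_size :: "'a graph \<Rightarrow> 'a set \<Rightarrow> nat" where
  "contracted_size G U = card {e \<in> edges G. e \<inter> U = {}} + card (nbs G U)"

lemma contracted_size_singleton:
  assumes "wf_graph G" "v \<in> verts G"
  shows "card (edges G) \<le> contracted_size G {v}"
proof -
  have fin: "finite (edges G)" "finite (nbs G {v})"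
    using wf_graph_finite_edges[OF assms(1)] wf_graph_finite_verts[OF assms(1)]
    by (auto simp: nbs_def)
  have "edges G \<subseteq> {e \<in> edges G. e \<inter> {v} = {}} \<union> (\<lambda>u. {u, v}) ` nbs G {v}"
  proof
    fix e assume e: "e \<in> edges G"
    show "e \<in> {e \<in> edges G. e \<inter> {v} = {}} \<union> (\<lambda>u. {u, v}) ` nbs G {v}"
    proof (cases "v \<in> e")
      case True
      then obtain u where "e = {u, v}" "u \<noteq> v" "u \<in> verts G"
        using wf_graph_edge_other_end[OF assms(1) e] by blast
      with e have "u \<in> nbs G {v}"
        by (auto simp: nbs_def insert_commute)
      with \<open>e = {u, v}\<close> show ?thesis by blast
    qed (use e in auto)
  qed
  then have "card (edges G) \<le> card ({e \<in> edges G. e \<inter> {v} = {}} \<union> (\<lambda>u. {u, v}) ` nbs G {v})"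
    using fin by (intro card_mono) auto
  also have "\<dots> \<le> card {e \<in> edges G. e \<inter> {v} = {}} + card ((\<lambda>u. {u, v}) ` nbs G {v})"
    by (rule card_Un_le)
  also have "\<dots> \<le> contracted_size G {v}"
    unfolding contracted_size_def using card_image_le[OF fin(2)] by auto
  finally show ?thesis .
qed

text \<open>Merging \<open>v\<close> into \<open>U\<close> loses the edge between them and, for each
  common neighbour, one of two edges that become parallel; the latter are counted by the edges at
  \<open>v\<close> inside \<open>nbs G U\<close>. Edges from \<open>v\<close> to \<open>Q\<close>
  survive, since they give \<open>U\<close> new neighbours.\<close>

lemma contracted_size_insert:
  assumes "wf_graph G" "v \<in> nbs G U"
  shows "contracted_size G U \<le>
    contracted_size G (insert v U) + 1 + card {e \<in> edges G. e \<subseteq> nbs G U \<and> v \<in> e}"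
proof -
  let ?N = "nbs G U"
  define Q where "Q = {u \<in> verts G - insert v U - ?N. {u, v} \<in> edges G}"
  let ?D = "{e \<in> edges G. e \<subseteq> ?N \<and> v \<in> e}"
  let ?A = "{e \<in> edges G. e \<inter> insert v U = {}}"
  have fin: "finite (edges G)" "finite (verts G)" "finite Q" "finite ?N"
    using wf_graph_finite_edges[OF assms(1)] wf_graph_finite_verts[OF assms(1)]
    by (auto simp: Q_def nbs_def)
  have "{e \<in> edges G. e \<inter> U = {}} \<subseteq> ?A \<union> (?D \<union> (\<lambda>u. {u, v}) ` Q)"
  proof
    fix e assume e: "e \<in> {e \<in> edges G. e \<inter> U = {}}"
    show "e \<in> ?A \<union> (?D \<union> (\<lambda>u. {u, v}) ` Q)"
    proof (cases "v \<in> e")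
      case True
      then obtain u where u: "e = {u, v}" "u \<noteq> v" "u \<in> verts G"
        using wf_graph_edge_other_end[OF assms(1)] e by blast
      then have "u \<in> Q \<or> u \<in> ?N"
        using e by (auto simp: Q_def)
      then show ?thesis
        using u e assms(2) by auto
    qed (use e in auto)
  qed
  then have "card {e \<in> edges G. e \<inter> U = {}} \<le> card (?A \<union> (?D \<union> (\<lambda>u. {u, v}) ` Q))"
    using fin by (intro card_mono) auto
  also have "\<dots> \<le> card ?A + (card ?D + card ((\<lambda>u. {u, v}) ` Q))"
    using card_Un_le[of ?A "?D \<union> (\<lambda>u. {u, v}) ` Q"] card_Un_le[of ?D "(\<lambda>u. {u, v}) ` Q"]
    by linarith
  also have "\<dots> \<le> card ?A + (card ?D + card Q)"
    using card_image_le[OF fin(3)] by simp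
  finally have A: "card {e \<in> edges G. e \<inter> U = {}} \<le> card ?A + (card ?D + card Q)" .
  have "(?N - {v}) \<union> Q \<subseteq> nbs G (insert v U)"
    using assms(2) by (auto simp: nbs_def Q_def insert_commute)
  then have "card ((?N - {v}) \<union> Q) \<le> card (nbs G (insert v U))"
    using fin by (intro card_mono) (auto simp: nbs_def)
  moreover have "card ((?N - {v}) \<union> Q) = card (?N - {v}) + card Q"
    using fin by (intro card_Un_disjoint) (auto simp: Q_def)
  moreover have "card (?N - {v}) + 1 = card ?N"
    using assms(2) fin by (metis Suc_eq_plus1 card.remove)
  ultimately show ?thesis
    using A unfolding contracted_size_def by linarith
qed

text \<open>Mader's contraction argument: U is a maximal connected set whose contraction does not
  decrease the density; if contracting a neighbour of U as well does, then that neighbour has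
  large degree inside the neighbourhood of U.\<close>

lemma dense_neighbourhood_of_connected_set:
  assumes "wf_graph G" "verts G \<noteq> {}" "c * card (verts G) \<le> card (edges G)" "1 \<le> c"
  shows "\<exists>U N. U \<subseteq> verts G \<and> connected_in (edges G) U \<and> N \<subseteq> nbs G U \<and> N \<noteq> {} \<and>
    c * card N \<le> 2 * card {e \<in> edges G. e \<subseteq> N}"
  using assms
proof (induction "card (verts G)" arbitrary: G rule: less_induct)
  case less
  define V E where "V = verts G" and "E = edges G"
  have finV: "finite V" and finE: "finite E"
    using wf_graph_finite_edges[OF less.prems(1)] wf_graph_finite_verts[OF less.prems(1)]
    by (auto simp: V_def E_def)
  \<comment> \<open>The contraction of \<open>U\<close> has \<open>card V - card U + 1\<close>
    vertices. The inequality says that it has at least \<open>c\<close> edges per vertex, with the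
    subtraction moved to the other side.\<close>
  define P where "P U \<longleftrightarrow> U \<subseteq> V \<and> U \<noteq> {} \<and> connected_in E U \<and>
    c * card V + c \<le> contracted_size G U + c * card U" for U
  obtain v0 where v0: "v0 \<in> V"
    using less.prems V_def by blast
  have "P {v0}"
    unfolding P_def using v0 less.prems contracted_size_singleton[OF less.prems(1), of v0]
    by (auto simp: connected_in_def V_def)
  moreover have "\<forall>U. P U \<longrightarrow> card U < Suc (card V)"
    unfolding P_def using finV by (auto simp: card_mono less_Suc_eq_le)
  ultimately obtain U where U: "P U" and max: "\<And>U'. P U' \<Longrightarrow> card U' \<le> card U"
    using ex_has_greatest_nat[of P "{v0}" card "Suc (card V)"] by blast
  let ?N = "nbs G U"
  have NV: "?N \<subseteq> V - U" by (auto simp: nbs_def V_def)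
  have UV: "U \<subseteq> V"
    using U by (simp add: P_def)
  have finU: "finite U" and cU: "card U \<le> card V"
    using finite_subset[OF UV finV] card_mono[OF finV UV] by simp_all
  show ?case
  proof (cases "?N = {}")
    case True
    \<comment> \<open>Without neighbours, \<open>U\<close> contracts to an isolated vertex, so all
      edges counted lie outside \<open>U\<close>. The graph without \<open>U\<close> is therefore
      still dense enough for the induction hypothesis.\<close>
    define G' where "G' = (V - U, {e \<in> E. e \<inter> U = {}})"
    have wf': "wf_graph G'"
      unfolding G'_def using wf_graph_edge_subset[OF less.prems(1)]
      by (intro wf_graph_subgraph[OF less.prems(1)]) (auto simp: V_def E_def)
    have size: "c * card V + c \<le> card {e \<in> E. e \<inter> U = {}} + c * card U"
      using U True by (simp add: P_def contracted_size_def E_def)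
    have "V - U \<noteq> {}"
    proof
      assume "V - U = {}"
      then have "V = U" using U by (auto simp: P_def)
      with size less.prems(4) have "card {e \<in> E. e \<inter> U = {}} \<noteq> 0"
        by auto
      then obtain e where "e \<in> E" "e \<inter> V = {}"
        using \<open>V = U\<close> by (metis (mono_tags, lifting) card.empty empty_Collect_eq)
      moreover from this obtain u v where "e = {u, v}" "u \<in> V"
        using wf_graph_edgeE[OF less.prems(1), of e] by (metis E_def V_def)
      ultimately show False by auto
    qed
    moreover have "card (V - U) = card V - card U"
      using U finU by (intro card_Diff_subset) (auto simp: P_def)
    moreover have "c * card V = c * (card V - card U) + c * card U"
      using cU by (simp add: add_mult_distrib2[symmetric])
    moreover have "card V - card U < card V"
      using U finU cU by (metis P_def card_gt_0_iff diff_less order_less_le_trans)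
    ultimately have "\<exists>U' N. U' \<subseteq> verts G' \<and> connected_in (edges G') U' \<and> N \<subseteq> nbs G' U' \<and> N \<noteq> {} \<and>
        c * card N \<le> 2 * card {e \<in> edges G'. e \<subseteq> N}"
      using size wf' less.prems(4) by (intro less.hyps) (auto simp: G'_def V_def)
    then obtain U' N where *: "U' \<subseteq> V - U" "connected_in (edges G') U'" "N \<subseteq> nbs G' U'" "N \<noteq> {}"
        "c * card N \<le> 2 * card {e \<in> edges G'. e \<subseteq> N}"
      by (auto simp: G'_def)
    have "connected_in E U'"
      by (rule connected_in_mono[OF *(2)]) (auto simp: G'_def)
    moreover have "N \<subseteq> nbs G U'"
      using *(3) by (auto simp: nbs_def G'_def V_def E_def)
    moreover have "card {e \<in> edges G'. e \<subseteq> N} \<le> card {e \<in> E. e \<subseteq> N}"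
      using finE by (intro card_mono) (auto simp: G'_def)
    ultimately show ?thesis
      using * by (intro exI[of _ U'] exI[of _ N]) (auto simp: V_def E_def)
  next
    case False
    \<comment> \<open>By maximality, contracting \<open>insert v U\<close> falls below density
      \<open>c\<close>. Merging \<open>v\<close> removes one vertex, so it must lose more than
      \<open>c\<close> edges; all but one of these are accounted for by the degree of
      \<open>v\<close> inside \<open>?N\<close>.\<close>
    have deg: "c \<le> card {e \<in> {e \<in> E. e \<subseteq> ?N}. v \<in> e}" if v: "v \<in> ?N" for v
    proof -
      obtain u where u: "u \<in> U" "{u, v} \<in> E"
        using v by (auto simp: nbs_def E_def)
      have "v \<notin> U" "v \<in> V" using v NV by auto
      then have card': "card (insert v U) = Suc (card U)"
        using finU by simp
      then have "\<not> P (insert v U)"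
        using max by fastforce
      moreover have "connected_in E (insert v U)"
        using U connected_in_insert[OF _ u] by (simp add: P_def)
      ultimately have "contracted_size G (insert v U) + c * Suc (card U) < c * card V + c"
        using \<open>v \<in> V\<close> U card' by (auto simp: P_def)
      moreover have "c * card V + c \<le> contracted_size G U + c * card U"
        using U by (simp add: P_def)
      moreover have "{e \<in> {e \<in> E. e \<subseteq> ?N}. v \<in> e} = {e \<in> edges G. e \<subseteq> ?N \<and> v \<in> e}"
        by (auto simp: E_def)
      ultimately show ?thesis
        using contracted_size_insert[OF less.prems(1) v] by simp
    qed
    have "wf_graph (?N, {e \<in> E. e \<subseteq> ?N})"
      using NV by (intro wf_graph_subgraph[OF less.prems(1)]) (auto simp: V_def E_def)
    from handshake[OF this]
    have "(\<Sum>v\<in>?N. card {e \<in> {e \<in> E. e \<subseteq> ?N}. v \<in> e}) = 2 * card {e \<in> E. e \<subseteq> ?N}"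
      by simp
    moreover have "c * card ?N \<le> (\<Sum>v\<in>?N. card {e \<in> {e \<in> E. e \<subseteq> ?N}. v \<in> e})"
      using sum_bounded_below[of ?N c "\<lambda>v. card {e \<in> {e \<in> E. e \<subseteq> ?N}. v \<in> e}"] deg
      by (simp add: mult.commute)
    ultimately show ?thesis
      using False U by (intro exI[of _ U] exI[of _ ?N]) (auto simp: P_def V_def E_def)
  qed
qed

lemma card_edges_le_square:
  assumes "wf_graph G"
  shows "card (edges G) \<le> card (verts G) * card (verts G)"
proof -
  have fin: "finite (verts G)"
    using assms by (simp add: wf_graph_def)
  have "edges G \<subseteq> (\<lambda>(u, v). {u, v}) ` (verts G \<times> verts G)"
    by (auto elim!: wf_graph_edgeE[OF assms])
  then have "card (edges G) \<le> card (verts G \<times> verts G)"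
    using fin by (meson card_image_le card_mono finite_SigmaI finite_imageI order_trans)
  then show ?thesis
    by (simp add: card_cartesian_product)
qed

text \<open>Induction on the edges of \<open>H\<close>: drop an edge \<open>ab\<close>, find a
  subdivision of the rest inside the dense neighbourhood \<open>N\<close>, and join the
  representatives of \<open>a\<close> and \<open>b\<close> by a path through the connected set
  \<open>U\<close>, which is disjoint from \<open>N\<close>. Passing to \<open>N\<close> halves the
  density, whence the power of 2.\<close>

theorem dense_graph_contains_subdivision:
  fixes VH :: "'a set" and G :: "'b graph"
  assumes "finite EH" "wf_graph (VH, EH)" "wf_graph G" "verts G \<noteq> {}"
    and "2 ^ card EH * Suc (card VH) * card (verts G) \<le> card (edges G)"
  shows "\<exists>S. verts S \<subseteq> verts G \<and> edges S \<subseteq> edges G \<and> subdivision_of (VH, EH) S"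
  using assms
proof (induction EH arbitrary: G rule: finite_induct)
  case empty
  \<comment> \<open>A graph on \<open>n\<close> vertices has at most \<open>n * n\<close> edges, so
    the density alone forces enough vertices to place \<open>VH\<close>.\<close>
  have "Suc (card VH) * card (verts G) \<le> card (verts G) * card (verts G)"
    using empty.prems card_edges_le_square[of G] by simp
  moreover have fin: "finite (verts G)" "finite VH"
    using empty.prems by (auto simp: wf_graph_def)
  ultimately have "card VH \<le> card (verts G)"
    using empty.prems by (metis Suc_leD card_gt_0_iff mult_le_cancel2)
  then obtain \<phi> where \<phi>: "\<phi> ` VH \<subseteq> verts G" "inj_on \<phi> VH"
    using card_le_inj[OF fin(2,1)] by blast
  have "subdivision_of (VH, {}) (\<phi> ` VH, {} :: 'b set set)"
    using \<phi> fin by (intro subdivision_of.iso)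
      (auto simp: wf_graph_def graph_iso_def bij_betw_def intro!: exI[of _ \<phi>])
  then show ?case
    using \<phi> by (intro exI[of _ "(\<phi> ` VH, {})"]) auto
next
  case (insert e EH)
  obtain a b where ab: "e = {a, b}" "a \<noteq> b" "a \<in> VH" "b \<in> VH"
    using wf_graph_edgeE[OF insert.prems(1), of e] by auto
  define c where "c = 2 ^ card EH * Suc (card VH)"
  have dense: "2 * c * card (verts G) \<le> card (edges G)"
    using insert.prems(4) insert.hyps by (simp add: c_def algebra_simps)
  have "1 \<le> 2 * c" by (simp add: c_def Suc_le_eq)
  then obtain U N where U: "U \<subseteq> verts G" "connected_in (edges G) U"
    and N: "N \<subseteq> nbs G U" "N \<noteq> {}" "2 * c * card N \<le> 2 * card {e \<in> edges G. e \<subseteq> N}"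
    using dense_neighbourhood_of_connected_set[OF insert.prems(2,3) dense] by blast
  let ?GN = "(N, {e \<in> edges G. e \<subseteq> N})"
  have NV: "N \<subseteq> verts G - U"
    using N(1) by (auto simp: nbs_def)
  have "wf_graph ?GN"
    using NV by (intro wf_graph_subgraph[OF insert.prems(2)]) auto
  moreover have "wf_graph (VH, EH)"
    using insert.prems(1) by (auto simp: wf_graph_def)
  moreover have "c * card N \<le> card {e \<in> edges G. e \<subseteq> N}"
    using N(3) by linarith
  ultimately obtain S where S: "verts S \<subseteq> N" "edges S \<subseteq> {e \<in> edges G. e \<subseteq> N}"
      "subdivision_of (VH, EH) S"
    using insert.IH[of ?GN] N(2) unfolding c_def verts_Pair edges_Pair by blast
  obtain x y where xy: "x \<in> verts S" "y \<in> verts S" "x \<noteq> y" "{x, y} \<notin> edges S"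
    and sub: "subdivision_of (VH, insert e EH) (verts S, insert {x, y} (edges S))"
    using subdivision_of_add_edge[OF S(3) ab(3,4,2)] insert.hyps ab(1) by blast
  \<comment> \<open>\<open>u\<close> and \<open>v\<close> may coincide; then \<open>xs\<close> is
    empty and \<open>u\<close> is the only interior vertex of the connecting path.\<close>
  obtain u v where uv: "u \<in> U" "v \<in> U" "{x, u} \<in> edges G" "{v, y} \<in> edges G"
  proof -
    have "x \<in> nbs G U" "y \<in> nbs G U"
      using xy(1,2) S(1) N(1) by auto
    then show ?thesis
      using that by (auto simp: nbs_def insert_commute)
  qed
  let ?r = "\<lambda>a b. {a, b} \<in> edges G \<and> b \<in> U"
  have "?r\<^sup>*\<^sup>* u v"
    using U(2) uv by (auto simp: connected_in_def)
  then obtain zs where "rtrancl_path ?r u zs v"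
    by (auto simp: rtranclp_eq_rtrancl_path)
  then obtain xs where xs: "rtrancl_path ?r u xs v" "distinct (u # xs)"
    by (rule rtrancl_path_distinct)
  have "set xs \<subseteq> U"
    using xs(1) by (induction rule: rtrancl_path.induct) auto
  then have ps: "set (u # xs) \<subseteq> U"
    using uv by simp
  have "path_edges u xs y \<subseteq> edges G"
    using xs(1) uv(4) by (intro path_edges_subset[of ?r]) auto
  moreover have "subdivision_of (VH, insert e EH)
      (verts S \<union> set (u # xs), edges S \<union> path_edges x (u # xs) y)"
    using xy ps NV S(1) xs(2) by (intro subdivision_of_edge_to_path[OF sub]) auto
  ultimately show ?case
    using S(1,2) ps U(1) NV uv(3)
    by (intro exI[of _ "(verts S \<union> set (u # xs), edges S \<union> path_edges x (u # xs) y)"]) auto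
qed

section \<open>Bridgeless edge sets\<close>

text \<open>Bridgeless edge sets stand in for cycles: the edge set of a cycle is bridgeless, and the
  cut formulation is stable under subdividing edges without any bookkeeping of vertex sequences.\<close>

definition crosses :: "'a set \<Rightarrow> 'a set \<Rightarrow> bool" where
  "crosses e W \<longleftrightarrow> e \<inter> W \<noteq> {} \<and> \<not> e \<subseteq> W"

text \<open>No edge cut meets \<open>F\<close> in exactly one edge; for two-element edges this says
  that every edge of \<open>F\<close> lies on a cycle within \<open>F\<close>. The empty set
  qualifies, so nonemptiness is always demanded separately.\<close>

definition bridgeless :: "'a set set \<Rightarrow> bool" where
  "bridgeless F \<longleftrightarrow> (\<forall>W. \<forall>e\<in>F. crosses e W \<longrightarrow> (\<exists>e'\<in>F. e' \<noteq> e \<and> crosses e' W))"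

lemma crosses_pair: "crosses {u, v} W \<longleftrightarrow> (u \<in> W) \<noteq> (v \<in> W)"
  by (auto simp: crosses_def)

lemma crosses_image:
  assumes "e \<subseteq> A"
  shows "crosses (f ` e) W \<longleftrightarrow> crosses e {x \<in> A. f x \<in> W}"
  using assms by (auto simp: crosses_def)

text \<open>If \<open>e\<close> alone crossed \<open>W\<close>, a walk round the cycle from one end
  of \<open>e\<close> would stay on one side of \<open>W\<close> until it reached the other end, so
  \<open>e\<close> would not cross either.\<close>

lemma bridgeless_cycle:
  assumes "length vs \<ge> 3" "distinct vs"
  shows "bridgeless ((\<lambda>i. {vs ! i, vs ! ((i + 1) mod length vs)}) ` {..<length vs})"
    (is "bridgeless (?e ` _)")
  unfolding bridgeless_def
proof (intro allI ballI impI)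
  fix W e
  assume "e \<in> ?e ` {..<length vs}" and cr: "crosses e W"
  then obtain i where i: "i < length vs" "e = ?e i" by auto
  let ?n = "length vs"
  show "\<exists>e'\<in>?e ` {..<?n}. e' \<noteq> e \<and> crosses e' W"
  proof (rule ccontr)
    assume "\<not> ?thesis"
    then have no: "\<not> crosses (?e j) W \<or> ?e j = e" if "j < ?n" for j
      using that by auto
    \<comment> \<open>This is where length at least 3 matters: two positions carrying the same edge
      would be successors of each other, a cycle of length 2.\<close>
    have e_inj: "?e j \<noteq> ?e i" if "j < ?n" "j \<noteq> i" for j
    proof
      assume eq: "?e j = ?e i"
      have l: "(j + 1) mod ?n < ?n" "(i + 1) mod ?n < ?n"
        using assms(1) by (auto intro: mod_less_divisor)
      have "vs ! j \<noteq> vs ! i"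
        using that i assms(2) by (simp add: nth_eq_iff_index_eq)
      with eq have "vs ! j = vs ! ((i + 1) mod ?n)" "vs ! ((j + 1) mod ?n) = vs ! i"
        by (auto simp: doubleton_eq_iff)
      then have "j = (i + 1) mod ?n" "(j + 1) mod ?n = i"
        using that i l assms(2) by (simp_all add: nth_eq_iff_index_eq)
      then have "(i + 2) mod ?n = i"
        by (metis add.assoc mod_add_left_eq one_add_one)
      then show False
        using i assms(1) by (cases "i + 2 < ?n") (auto simp: mod_if split: if_splits)
    qed
    have same: "vs ! ((i + 1 + k) mod ?n) \<in> W \<longleftrightarrow> vs ! ((i + 1) mod ?n) \<in> W" if "k < ?n" for k
      using that
    proof (induction k)
      case (Suc k)
      let ?j = "(i + 1 + k) mod ?n"
      have j: "?j < ?n"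
        using i by (intro mod_less_divisor) auto
      have "?j \<noteq> i"
      proof
        assume "?j = i"
        then have "(i + Suc k) mod ?n = i mod ?n" using i by simp
        then have "Suc k mod ?n = 0"
          by (metis add_diff_cancel_left' le_add1 mod_eq_dvd_iff_nat dvd_imp_mod_0)
        then show False using Suc.prems by simp
      qed
      then have "\<not> crosses (?e ?j) W"
        using no[OF j] e_inj[OF j] i by blast
      moreover have "(?j + 1) mod ?n = (i + 1 + Suc k) mod ?n"
        by (simp add: mod_Suc_eq)
      ultimately show ?case
        using Suc by (simp add: crosses_pair)
    qed simp
    have "i + 1 + (?n - 1) = i + ?n"
      using i by simp
    then have "(i + 1 + (?n - 1)) mod ?n = i"
      using i by (metis mod_add_self2 mod_less)
    then have "vs ! i \<in> W \<longleftrightarrow> vs ! ((i + 1) mod ?n) \<in> W"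
      using same[of "?n - 1"] i by (metis diff_less gr_implies_not0 neq0_conv zero_less_one)
    then show False
      using cr i by (simp add: crosses_pair)
  qed
qed

lemma has_cycle_bridgeless:
  assumes "has_cycle H"
  obtains F where "F \<subseteq> edges H" "F \<noteq> {}" "bridgeless F"
proof -
  obtain vs where vs: "length vs \<ge> 3" "distinct vs"
      "\<forall>i < length vs. {vs ! i, vs ! ((i + 1) mod length vs)} \<in> edges H"
    using assms by (auto simp: has_cycle_def)
  show thesis
  proof
    show "(\<lambda>i. {vs ! i, vs ! ((i + 1) mod length vs)}) ` {..<length vs} \<subseteq> edges H"
      using vs(3) by auto
    show "(\<lambda>i. {vs ! i, vs ! ((i + 1) mod length vs)}) ` {..<length vs} \<noteq> {}"
      using vs(1) by (auto simp: lessThan_empty_iff)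
  qed (rule bridgeless_cycle[OF vs(1,2)])
qed

text \<open>A cut of the image pulls back along \<open>\<phi>\<close> to a cut crossed by the
  corresponding edges, and injectivity keeps distinct edges distinct.\<close>

lemma bridgeless_image:
  assumes "bridgeless F" "inj_on \<phi> A" "\<And>e. e \<in> F \<Longrightarrow> e \<subseteq> A"
  shows "bridgeless ((`) \<phi> ` F)"
  unfolding bridgeless_def
proof (intro allI ballI impI)
  fix W e assume "e \<in> (`) \<phi> ` F" "crosses e W"
  then obtain d where d: "d \<in> F" "e = \<phi> ` d" "crosses (\<phi> ` d) W"
    by auto
  then have "crosses d {x \<in> A. \<phi> x \<in> W}"
    using crosses_image[OF assms(3)] by blast
  with d(1) obtain d' where d': "d' \<in> F" "d' \<noteq> d" "crosses d' {x \<in> A. \<phi> x \<in> W}"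
    using assms(1) unfolding bridgeless_def by blast
  then have "\<phi> ` d' \<noteq> \<phi> ` d"
    using inj_on_image_eq_iff[OF assms(2,3,3)] d(1) by blast
  moreover have "crosses (\<phi> ` d') W"
    using d' crosses_image[OF assms(3)] by blast
  ultimately show "\<exists>e'\<in>(`) \<phi> ` F. e' \<noteq> e \<and> crosses e' W"
    using d(2) d'(1) by (intro bexI[of _ "\<phi> ` d'"]) auto
qed

text \<open>If \<open>W\<close> separates \<open>u\<close> from \<open>v\<close>, exactly one half
  of the subdivided edge crosses \<open>W\<close> and takes over the role of \<open>{u, v}\<close>.
  Otherwise both halves cross and serve as partners of each other, or neither does.\<close>

lemma bridgeless_subdivide_edge:
  assumes "bridgeless F" "{u, v} \<in> F" "u \<noteq> v" "w \<noteq> u" "w \<noteq> v" "\<And>e. e \<in> F \<Longrightarrow> w \<notin> e"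
  shows "bridgeless ((F - {{u, v}}) \<union> {{u, w}, {w, v}})"
  unfolding bridgeless_def
proof (intro allI ballI impI)
  fix W e
  let ?F = "(F - {{u, v}}) \<union> {{u, w}, {w, v}}"
  assume e: "e \<in> ?F" "crosses e W"
  have new: "{u, w} \<notin> F" "{w, v} \<notin> F" "{u, w} \<noteq> {w, v}"
    using assms(3-6) by (auto simp: doubleton_eq_iff)
  show "\<exists>e'\<in>?F. e' \<noteq> e \<and> crosses e' W"
  proof (cases "crosses {u, v} W")
    case True
    then have one: "crosses {u, w} W \<noteq> crosses {w, v} W"
      by (auto simp: crosses_pair)
    show ?thesis
    proof (cases "e \<in> F")
      case True
      then have "e \<noteq> {u, w}" "e \<noteq> {w, v}" using new by auto
      then show ?thesis
        using one by (metis UnI2 insertCI)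
    next
      case False
      obtain e' where "e' \<in> F" "e' \<noteq> {u, v}" "crosses e' W"
        using assms(1,2) True unfolding bridgeless_def by blast
      then show ?thesis
        using \<open>e \<notin> F\<close> by (intro bexI[of _ e']) auto
    qed
  next
    case False
    then have both: "crosses {u, w} W = crosses {w, v} W"
      by (auto simp: crosses_pair)
    show ?thesis
    proof (cases "e \<in> F")
      case True
      then obtain e' where "e' \<in> F" "e' \<noteq> e" "crosses e' W"
        using assms(1) e unfolding bridgeless_def by blast
      then show ?thesis
        using \<open>\<not> crosses {u, v} W\<close> by (intro bexI[of _ e']) auto
    next
      case False
      then have "e = {u, w} \<or> e = {w, v}" using e by auto
      then show ?thesis
        using both e(2) new(3) by (metis UnI2 insertCI)
    qed
  qed
qed

text \<open>The cycle of \<open>H\<close> persists: a subdivision step replaces an edge of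
  \<open>F\<close> by its two halves or leaves \<open>F\<close> alone. With the girth of the host
  this bounds every subdivision of \<open>H\<close> from below.\<close>

lemma subdivision_of_bridgeless:
  assumes "subdivision_of H S" "wf_graph H" "has_cycle H"
  shows "\<exists>F. F \<subseteq> edges S \<and> F \<noteq> {} \<and> bridgeless F"
  using assms(1)
proof (induction rule: subdivision_of.induct)
  case (iso S)
  then obtain \<phi> where \<phi>: "bij_betw \<phi> (verts H) (verts S)"
    and ed: "\<And>u v. u \<in> verts H \<Longrightarrow> v \<in> verts H \<Longrightarrow> {u, v} \<in> edges H \<longleftrightarrow> {\<phi> u, \<phi> v} \<in> edges S"
    by (auto simp: graph_iso_def)
  obtain F where F: "F \<subseteq> edges H" "F \<noteq> {}" "bridgeless F"
    using has_cycle_bridgeless[OF assms(3)] by blast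
  have "(`) \<phi> ` F \<subseteq> edges S"
  proof
    fix d assume "d \<in> (`) \<phi> ` F"
    then obtain e where e: "e \<in> edges H" "d = \<phi> ` e"
      using F(1) by auto
    then obtain u v where "e = {u, v}" "u \<in> verts H" "v \<in> verts H"
      using wf_graph_edgeE[OF assms(2) e(1)] by metis
    then show "d \<in> edges S"
      using e ed by auto
  qed
  moreover have "bridgeless ((`) \<phi> ` F)"
    using F(1) wf_graph_edge_subset[OF assms(2)] \<phi>
    by (intro bridgeless_image[OF F(3)]) (auto simp: bij_betw_def)
  ultimately show ?case
    using F(2) by blast
next
  case (step S u v w)
  then obtain F where F: "F \<subseteq> edges S" "F \<noteq> {}" "bridgeless F"
    by blast
  note wf = wf_graph_edge_subset[OF subdivision_of_wf[OF step.hyps(1)]]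
  show ?case
  proof (cases "{u, v} \<in> F")
    case True
    have "bridgeless ((F - {{u, v}}) \<union> {{u, w}, {w, v}})"
      using F(1) wf step.hyps(2,4)
      by (intro bridgeless_subdivide_edge[OF F(3) True step.hyps(3)]) blast+
    then show ?thesis
      using F(1) by (intro exI[of _ "(F - {{u, v}}) \<union> {{u, w}, {w, v}}"]) auto
  next
    case False
    then show ?thesis
      using F by (intro exI[of _ F]) auto
  qed
qed

section \<open>Dense graphs of bounded degree and logarithmic girth\<close>

text \<open>This is the usual girth condition, since a nonempty finite bridgeless set of edges contains
  a cycle and cycles are bridgeless. (An infinite union would have cardinality 0.)\<close>

definition girth_at_least :: "nat \<Rightarrow> 'a set set \<Rightarrow> bool" where
  "girth_at_least g E \<longleftrightarrow> (\<forall>F\<subseteq>E. F \<noteq> {} \<longrightarrow> bridgeless F \<longrightarrow> g \<le> card (\<Union>F))"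

fun ball_in :: "'a graph \<Rightarrow> 'a \<Rightarrow> nat \<Rightarrow> 'a set" where
  "ball_in G u 0 = {u}"
| "ball_in G u (Suc i) = ball_in G u i \<union> nbs G (ball_in G u i)"

lemma ball_in_mono: "i \<le> j \<Longrightarrow> ball_in G u i \<subseteq> ball_in G u j"
  by (induction rule: dec_induct) auto

lemma card_nbs_le:
  assumes "wf_graph G" "finite B" "\<And>v. card {e \<in> edges G. v \<in> e} \<le> d"
  shows "card (nbs G B) \<le> card B * d"
proof -
  have fin: "finite {e \<in> edges G. b \<in> e}" for b
    using wf_graph_finite_edges[OF assms(1)] by simp
  \<comment> \<open>\<open>the_elem (e - {b})\<close> is the end of \<open>e\<close> other than
    \<open>b\<close>.\<close>
  have "nbs G B \<subseteq> (\<Union>b\<in>B. (\<lambda>e. the_elem (e - {b})) ` {e \<in> edges G. b \<in> e})"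
  proof
    fix v assume "v \<in> nbs G B"
    then obtain b where b: "b \<in> B" "{b, v} \<in> edges G" "v \<noteq> b"
      by (auto simp: nbs_def)
    then have "v = the_elem ({b, v} - {b})"
      by (simp add: insert_Diff_if)
    then show "v \<in> (\<Union>b\<in>B. (\<lambda>e. the_elem (e - {b})) ` {e \<in> edges G. b \<in> e})"
      using b by blast
  qed
  then have "card (nbs G B) \<le> card (\<Union>b\<in>B. (\<lambda>e. the_elem (e - {b})) ` {e \<in> edges G. b \<in> e})"
    using assms(2) fin by (intro card_mono) auto
  also have "\<dots> \<le> (\<Sum>b\<in>B. card ((\<lambda>e. the_elem (e - {b})) ` {e \<in> edges G. b \<in> e}))"
    using assms(2) by (rule card_UN_le)
  also have "\<dots> \<le> (\<Sum>b\<in>B. d)"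
    by (intro sum_mono order_trans[OF card_image_le[OF fin] assms(3)])
  finally show ?thesis by simp
qed

lemma card_ball_in_le:
  assumes "wf_graph G" "\<And>v. card {e \<in> edges G. v \<in> e} \<le> d"
  shows "finite (ball_in G u i) \<and> card (ball_in G u i) \<le> Suc d ^ i"
proof (induction i)
  case (Suc i)
  have "finite (nbs G (ball_in G u i))"
    using wf_graph_finite_verts[OF assms(1)] by (simp add: nbs_def)
  moreover have "card (nbs G (ball_in G u i)) \<le> card (ball_in G u i) * d"
    using Suc card_nbs_le[OF assms(1) _ assms(2)] by blast
  then have "card (ball_in G u (Suc i)) \<le> card (ball_in G u i) * Suc d"
    using card_Un_le[of "ball_in G u i" "nbs G (ball_in G u i)"] by simp
  moreover have "card (ball_in G u i) * Suc d \<le> Suc d ^ i * Suc d"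
    using Suc by (intro mult_right_mono) auto
  ultimately show ?case
    using Suc by (simp add: mult.commute)
qed simp

lemma rtrancl_path_ball_in:
  assumes "rtrancl_path r x xs y" "\<And>a b. r a b \<Longrightarrow> {a, b} \<in> edges G" "wf_graph G"
    and "x \<in> ball_in G u i"
  shows "y \<in> ball_in G u (i + length xs)"
  using assms
proof (induction arbitrary: i rule: rtrancl_path.induct)
  case (step x y ys z)
  have "y \<in> verts G"
    using wf_graph_edge_subset[OF step.prems(2)] step.prems(1) step.hyps(1) by blast
  then have "y \<in> ball_in G u (Suc i)"
    using step.prems(1,3) step.hyps(1) by (auto simp: nbs_def)
  then show ?case
    using step.IH[OF step.prems(1,2), of "Suc i"] by simp
qed simp

text \<open>Recovers a cycle through \<open>{u, v}\<close> from the cut condition. If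
  \<open>v\<close> were unreachable from \<open>u\<close> without this edge, the set of reachable
  vertices would be a cut crossed by \<open>{u, v}\<close>, hence by a second edge of
  \<open>F\<close>, which would lead to a further reachable vertex.\<close>

lemma bridgeless_edge_detour:
  assumes "bridgeless F" "{u, v} \<in> F" "u \<noteq> v" "finite (\<Union>F)"
    and "\<And>e. e \<in> F \<Longrightarrow> card e = 2"
  obtains xs where "rtrancl_path (\<lambda>a b. {a, b} \<in> F - {{u, v}}) u xs v" "length xs < card (\<Union>F)"
proof -
  let ?r = "\<lambda>a b. {a, b} \<in> F - {{u, v}}"
  have "?r\<^sup>*\<^sup>* u v"
  proof (rule ccontr)
    assume v: "\<not> ?r\<^sup>*\<^sup>* u v"
    define W where "W = {x. ?r\<^sup>*\<^sup>* u x}"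
    have "crosses {u, v} W"
      using v by (auto simp: crosses_pair W_def)
    then obtain e where e: "e \<in> F" "e \<noteq> {u, v}" "crosses e W"
      using assms(1,2) unfolding bridgeless_def by blast
    obtain a b where "e = {a, b}"
      using assms(5)[OF e(1)] by (auto simp: card_2_iff)
    with e(3) obtain x y where "e = {x, y}" "x \<in> W" "y \<notin> W"
      by (cases "a \<in> W") (auto simp: crosses_pair doubleton_eq_iff)
    moreover from this have "?r x y"
      using e(1,2) by simp
    ultimately have "y \<in> W"
      unfolding W_def mem_Collect_eq by (metis (no_types, lifting) rtranclp.rtrancl_into_rtrancl)
    with \<open>y \<notin> W\<close> show False ..
  qed
  then obtain zs where "rtrancl_path ?r u zs v"
    by (auto simp: rtranclp_eq_rtrancl_path)
  then obtain xs where xs: "rtrancl_path ?r u xs v" "distinct (u # xs)"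
    by (rule rtrancl_path_distinct)
  have "set xs \<subseteq> \<Union>F"
    using xs(1) by (induction rule: rtrancl_path.induct) auto
  then have "set (u # xs) \<subseteq> \<Union>F"
    using assms(2) by auto
  then have "card (set (u # xs)) \<le> card (\<Union>F)"
    using assms(4) by (intro card_mono)
  then have "length xs < card (\<Union>F)"
    using distinct_card[OF xs(2)] by simp
  with xs(1) show thesis by (rule that)
qed


text \<open>Two nonadjacent vertices of degree below \<open>d\<close> must be close, since otherwise
  the edge between them could be added. So all such vertices lie in a ball around any one of them,
  and the hypothesis on \<open>card V\<close> makes this ball at most half of the graph.\<close>

theorem dense_girth_graph_exists:
  fixes V :: "'a set"
  assumes "finite V" "1 \<le> g" "2 * Suc d ^ g \<le> card V"
  shows "\<exists>E. wf_graph (V, E) \<and> (\<forall>v. card {e \<in> E. v \<in> e} \<le> d) \<and> girth_at_least g E \<and>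
    d * card V \<le> 4 * card E"
proof -
  define P where "P E \<longleftrightarrow> wf_graph (V, E) \<and> (\<forall>v. card {e \<in> E. v \<in> e} \<le> d) \<and> girth_at_least g E" for E
  have "P {}"
    using assms(1) by (auto simp: P_def wf_graph_def girth_at_least_def)
  moreover have "\<forall>E. P E \<longrightarrow> card E < Suc (card V * card V)"
    using card_edges_le_square[of "(V, _)"] by (auto simp: P_def less_Suc_eq_le)
  ultimately obtain E where E: "P E" and max: "\<And>E'. P E' \<Longrightarrow> card E' \<le> card E"
    using ex_has_greatest_nat[of P "{}" card "Suc (card V * card V)"] by blast
  have wf: "wf_graph (V, E)" and deg: "\<And>v. card {e \<in> E. v \<in> e} \<le> d" and girth: "girth_at_least g E"
    using E by (auto simp: P_def)
  have finE: "finite E"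
    using wf_graph_finite_edges[OF wf] by simp
  define A where "A = {v \<in> V. card {e \<in> E. v \<in> e} < d}"
  have finA: "finite A" and AV: "A \<subseteq> V"
    using assms(1) by (auto simp: A_def)
  have near: "v \<in> ball_in (V, E) u g" if u: "u \<in> A" and v: "v \<in> A" for u v
  proof -
    have uv: "u \<in> V" "v \<in> V" using u v by (auto simp: A_def)
    consider "u = v" | "{u, v} \<in> E" | "u \<noteq> v" "{u, v} \<notin> E" by blast
    then show ?thesis
    proof cases
      case 1
      then show ?thesis
        using ball_in_mono[of 0 g "(V, E)" u] by auto
    next
      case 2
      then have "v \<in> ball_in (V, E) u 1"
        using uv by (auto simp: nbs_def)
      then show ?thesis
        using ball_in_mono[OF assms(2), of "(V, E)" u] by auto
    next
      case 3
      let ?E = "insert {u, v} E"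
      have "\<not> P ?E"
        using max[of ?E] 3 finE by auto
      moreover have "wf_graph (V, ?E)"
        using wf uv 3 by (auto simp: wf_graph_def)
      moreover have "card {e \<in> ?E. x \<in> e} \<le> d" for x
      proof (cases "x \<in> {u, v}")
        case True
        then have "{e \<in> ?E. x \<in> e} = insert {u, v} {e \<in> E. x \<in> e}" by auto
        moreover have "card {e \<in> E. x \<in> e} < d"
          using True u v by (auto simp: A_def)
        ultimately show ?thesis
          using card_insert_le_m1[of d "{e \<in> E. x \<in> e}" "{u, v}"] by simp
      next
        case False
        then have "{e \<in> ?E. x \<in> e} = {e \<in> E. x \<in> e}" by auto
        then show ?thesis using deg by simp
      qed
      \<comment> \<open>The degrees leave room for \<open>{u, v}\<close>, so only the girth can
        fail. A violating set must use the new edge, and its detour is a path of length below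
        \<open>g\<close> in \<open>E\<close>.\<close>
      ultimately have "\<not> girth_at_least g ?E"
        by (simp add: P_def)
      then obtain F where F: "F \<subseteq> ?E" "F \<noteq> {}" "bridgeless F" "card (\<Union>F) < g"
        by (auto simp: girth_at_least_def not_le)
      have mem: "{u, v} \<in> F"
      proof (rule ccontr)
        assume "{u, v} \<notin> F"
        then have "F \<subseteq> E" using F(1) by auto
        then have "g \<le> card (\<Union>F)"
          using girth F(2,3) unfolding girth_at_least_def by blast
        then show False using F(4) by simp
      qed
      have "\<Union>F \<subseteq> V"
      proof (rule Union_least)
        fix e assume "e \<in> F"
        then have "e = {u, v} \<or> e \<in> E" using F(1) by blast
        then show "e \<subseteq> V"
          using uv wf_graph_edge_subset[OF wf, of e] by auto
      qed
      then have fin: "finite (\<Union>F)"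
        using assms(1) finite_subset by blast
      have "card e = 2" if "e \<in> F" for e
        using that F(1) 3(1) card_edge[OF wf, of e] by auto
      from bridgeless_edge_detour[OF F(3) mem 3(1) fin this]
      obtain xs where xs: "rtrancl_path (\<lambda>a b. {a, b} \<in> F - {{u, v}}) u xs v" "length xs < card (\<Union>F)"
        by blast
      have "v \<in> ball_in (V, E) u (0 + length xs)"
        using F(1) by (intro rtrancl_path_ball_in[OF xs(1) _ wf]) auto
      moreover have "0 + length xs \<le> g"
        using xs(2) F(4) by simp
      ultimately show ?thesis
        using ball_in_mono[of "0 + length xs" g "(V, E)" u] by auto
    qed
  qed
  have cardA: "card A \<le> Suc d ^ g"
  proof (cases "A = {}")
    case False
    then obtain u where u: "u \<in> A" by blast
    have "finite (ball_in (V, E) u g) \<and> card (ball_in (V, E) u g) \<le> Suc d ^ g"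
      using deg by (intro card_ball_in_le[OF wf]) simp
    moreover from this have "card A \<le> card (ball_in (V, E) u g)"
      using near[OF u] by (intro card_mono) auto
    ultimately show ?thesis by linarith
  qed simp
  \<comment> \<open>At least half of the vertices have degree at least \<open>d\<close>, so the
    degree sum \<open>2 * card E\<close> is at least \<open>d * card V / 2\<close>.\<close>
  have "card V \<le> 2 * card (V - A)"
    using cardA assms(3) card_Diff_subset[OF finA AV] card_mono[OF assms(1) AV] by linarith
  then have "d * card V \<le> 2 * (d * card (V - A))"
    by (metis mult.left_commute mult_le_mono2)
  also have "d * card (V - A) \<le> (\<Sum>v\<in>V - A. card {e \<in> E. v \<in> e})"
    using sum_bounded_below[of "V - A" d "\<lambda>v. card {e \<in> E. v \<in> e}"]
    by (simp add: A_def mult.commute not_less)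
  also have "\<dots> \<le> (\<Sum>v\<in>V. card {e \<in> E. v \<in> e})"
    using assms(1) by (intro sum_mono2) auto
  also have "\<dots> = 2 * card E"
    using handshake[OF wf] by simp
  finally have "d * card V \<le> 4 * card E" by simp
  then show ?thesis
    using wf deg girth by blast
qed

section \<open>The one-subdivision of a graph\<close>

text \<open>The map \<open>s\<close> names the midpoint of each edge by an element of the same type,
  so the vertex type does not change; \<open>subdividing\<close> below says that these names are
  distinct and fresh.\<close>

definition one_subdivision :: "('a set \<Rightarrow> 'a) \<Rightarrow> 'a graph \<Rightarrow> 'a graph" where
  "one_subdivision s G = (verts G \<union> s ` edges G, {{u, s e} |u e. e \<in> edges G \<and> u \<in> e})"

definition subdividing :: "('a set \<Rightarrow> 'a) \<Rightarrow> 'a graph \<Rightarrow> bool" where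
  "subdividing s G \<longleftrightarrow> inj_on s (edges G) \<and> s ` edges G \<inter> verts G = {}"

lemma subdividing_subgraph:
  "subdividing s G \<Longrightarrow> verts S \<subseteq> verts G \<Longrightarrow> edges S \<subseteq> edges G \<Longrightarrow> subdividing s S"
  unfolding subdividing_def using inj_on_subset by blast

lemma wf_one_subdivision:
  assumes "wf_graph G" "subdividing s G"
  shows "wf_graph (one_subdivision s G)"
proof -
  have "\<exists>x y. x \<noteq> y \<and> x \<in> verts G \<union> s ` edges G \<and> y \<in> verts G \<union> s ` edges G \<and> {u, s e} = {x, y}"
    if e: "e \<in> edges G" and u: "u \<in> e" for u e
  proof -
    have "u \<in> verts G" using wf_graph_edge_subset[OF assms(1) e] u by blast
    moreover from this have "u \<noteq> s e" using e assms(2) by (auto simp: subdividing_def)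
    ultimately show ?thesis using e by blast
  qed
  then show ?thesis
    unfolding wf_graph_def one_subdivision_def verts_Pair edges_Pair
    using wf_graph_finite_verts[OF assms(1)] wf_graph_finite_edges[OF assms(1)] by auto
qed

lemma subdivision_of_one_subdivision:
  assumes sub: "subdivision_of H S" and "subdividing s S"
  shows "subdivision_of H (one_subdivision s S)"
proof -
  note wf = subdivision_of_wf[OF sub]
  have disj: "s e \<notin> verts S" if "e \<in> edges S" for e
    using assms(2) that by (auto simp: subdividing_def)
  \<comment> \<open>The intermediate state in which exactly the edges in \<open>F\<close> have been
    subdivided.\<close>
  have partial: "subdivision_of H (verts S \<union> s ` F, (edges S - F) \<union> {{u, s e} |u e. e \<in> F \<and> u \<in> e})"
    if "finite F" "F \<subseteq> edges S" for F
    using that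
  proof (induction rule: finite_induct)
    case empty
    then show ?case using sub by (simp add: verts_def edges_def)
  next
    case (insert e F)
    let ?N = "\<lambda>F. {{u, s e} |u e. e \<in> F \<and> u \<in> e}"
    have e: "e \<in> edges S" and F: "F \<subseteq> edges S" using insert.prems by auto
    obtain a b where ab: "e = {a, b}" "a \<noteq> b" "a \<in> verts S" "b \<in> verts S"
      using wf_graph_edgeE[OF wf e] by blast
    have new: "s e \<notin> verts S \<union> s ` F"
    proof -
      have "s e \<noteq> s f" if "f \<in> F" for f
        using that insert.hyps(2) F e assms(2) by (metis inj_onD subdividing_def subsetD)
      then show ?thesis using disj[OF e] by blast
    qed
    have "subdivision_of H (verts S \<union> s ` F, (edges S - F) \<union> ?N F)"
      using insert.IH F by blast
    from subdivision_of.step[OF this, of a b "s e"]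
    have "subdivision_of H ((verts S \<union> s ` F) \<union> {s e},
        (((edges S - F) \<union> ?N F) - {{a, b}}) \<union> {{a, s e}, {s e, b}})"
      using e insert.hyps(2) new ab(1,2) unfolding verts_Pair edges_Pair by blast
    moreover have "(verts S \<union> s ` F) \<union> {s e} = verts S \<union> s ` insert e F"
      by auto
    moreover have "{a, b} \<notin> ?N F"
    proof
      assume "{a, b} \<in> ?N F"
      then obtain u f where uf: "{a, b} = {u, s f}" "f \<in> F" by blast
      then have "s f \<in> {a, b}" by blast
      then show False using disj[of f] uf(2) F ab(3,4) by blast
    qed
    then have "((edges S - F) \<union> ?N F) - {{a, b}} = (edges S - insert e F) \<union> ?N F"
      using ab(1) by blast
    moreover have "?N (insert e F) = ?N F \<union> {{a, s e}, {s e, b}}"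
      using ab(1) by blast
    ultimately show ?case
      by (simp only: Un_assoc)
  qed
  from partial[OF wf_graph_finite_edges[OF wf] order_refl] show ?thesis
    by (simp add: one_subdivision_def)
qed

text \<open>Turns arbitrary subgraphs into induced ones: an edge of \<open>G\<close> between
  vertices of \<open>S\<close> that is not in \<open>S\<close> has its midpoint left out, so neither
  of its halves is induced.\<close>

lemma induced_one_subdivision:
  assumes "wf_graph G" "subdividing s G" "verts S \<subseteq> verts G" "edges S \<subseteq> edges G" "wf_graph S"
  shows "induced (one_subdivision s G) (verts S \<union> s ` edges S) = one_subdivision s S"
proof -
  have "{u, s e} \<subseteq> verts S \<union> s ` edges S \<longleftrightarrow> e \<in> edges S" if "e \<in> edges G" "u \<in> e" for u e
  proof
    assume "{u, s e} \<subseteq> verts S \<union> s ` edges S"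
    moreover have "s e \<notin> verts S"
      using that assms(2,3) by (auto simp: subdividing_def)
    ultimately obtain f where "f \<in> edges S" "s e = s f" by blast
    then show "e \<in> edges S"
      using that(1) assms(2,4) by (metis inj_onD subdividing_def subsetD)
  next
    assume "e \<in> edges S"
    then show "{u, s e} \<subseteq> verts S \<union> s ` edges S"
      using wf_graph_edge_subset[OF assms(5)] that(2) by blast
  qed
  then have "{d \<in> {{u, s e} |u e. e \<in> edges G \<and> u \<in> e}. d \<subseteq> verts S \<union> s ` edges S} =
      {{u, s e} |u e. e \<in> edges S \<and> u \<in> e}"
    using assms(4) by blast
  then show ?thesis
    by (simp add: induced_def one_subdivision_def)
qed

text \<open>\<open>F\<close> projects to the set \<open>C\<close> of edges of \<open>G\<close> that
  have a half in \<open>F\<close>. This set is again bridgeless, so the girth of \<open>G\<close>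
  applies to it, and the vertices it covers all lie in \<open>X\<close>.\<close>

lemma girth_one_subdivision:
  assumes "wf_graph G" "subdividing s G" "girth_at_least g (edges G)"
    and "X \<subseteq> verts (one_subdivision s G)"
    and F: "F \<subseteq> edges (induced (one_subdivision s G) X)" "F \<noteq> {}" "bridgeless F"
  shows "g \<le> card (X \<inter> verts G)"
proof -
  define C where "C = {e \<in> edges G. \<exists>u\<in>e. {u, s e} \<in> F}"
  have disj: "s e \<notin> verts G" if "e \<in> edges G" for e
    using assms(2) that by (auto simp: subdividing_def)
  have sinj: "e = f" if "s e = s f" "e \<in> edges G" "f \<in> edges G" for e f
    using assms(2) that by (auto simp: subdividing_def inj_on_def)
  have FE: "\<exists>u e. d = {u, s e} \<and> e \<in> edges G \<and> u \<in> e \<and> d \<subseteq> X" if "d \<in> F" for d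
  proof -
    have "d \<in> {{u, s e} |u e. e \<in> edges G \<and> u \<in> e}" "d \<subseteq> X"
      using F(1) that by (auto simp: induced_def one_subdivision_def)
    then show ?thesis by blast
  qed
  have inV: "u \<in> verts G" if "e \<in> edges G" "u \<in> e" for u e
    using wf_graph_edge_subset[OF assms(1)] that by blast
  have both: "{v, s e} \<in> F" if e: "e \<in> C" and v: "v \<in> e" for e v
  proof -
    obtain u where u: "u \<in> e" "{u, s e} \<in> F" "e \<in> edges G"
      using e by (auto simp: C_def)
    \<comment> \<open>The cut around the single midpoint \<open>s e\<close> is crossed only by the
      two halves of \<open>e\<close>, so one half in \<open>F\<close> forces the other.\<close>
    have "crosses {u, s e} {s e}"
      using inV[OF u(3,1)] disj[OF u(3)] by (auto simp: crosses_pair)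
    then obtain d where d: "d \<in> F" "d \<noteq> {u, s e}" "crosses d {s e}"
      using F(3) u(2) unfolding bridgeless_def by blast
    obtain w f where wf: "d = {w, s f}" "f \<in> edges G" "w \<in> f"
      using FE[OF d(1)] by blast
    have "s e \<in> d"
      using d(3) by (auto simp: crosses_def)
    then have "s e = s f"
      using wf disj[OF u(3)] inV[OF wf(2,3)] by auto
    then have "f = e" using sinj u(3) wf(2) by metis
    then have "w \<in> e" "w \<noteq> u" "{w, s e} \<in> F"
      using wf d by auto
    moreover obtain a b where "e = {a, b}"
      using wf_graph_edgeE[OF assms(1) u(3)] by blast
    ultimately show ?thesis
      using u v by auto
  qed
  have "bridgeless C"
    unfolding bridgeless_def
  proof (intro allI ballI impI)
    fix W e assume e: "e \<in> C" and cr: "crosses e W"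
    have eG: "e \<in> edges G" using e by (simp add: C_def)
    \<comment> \<open>Lifts the cut \<open>W\<close> from \<open>G\<close>: a midpoint joins the
      side of \<open>W\<close> only if its whole edge does. A crossing edge is then cut precisely at
      the half whose original end lies in \<open>W\<close>.\<close>
    define W' where "W' = (W \<inter> verts G) \<union> s ` {f \<in> edges G. f \<subseteq> W}"
    have s_W': "s f \<in> W' \<longleftrightarrow> f \<subseteq> W" if "f \<in> edges G" for f
      using that disj[OF that] sinj by (auto simp: W'_def)
    have v_W': "v \<in> W' \<longleftrightarrow> v \<in> W" if "v \<in> verts G" for v
      using that disj by (auto simp: W'_def)
    obtain u where u: "u \<in> e" "u \<in> W" and not_sub: "\<not> e \<subseteq> W"
      using cr by (auto simp: crosses_def)
    have "crosses {u, s e} W'"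
      using u not_sub s_W'[OF eG] v_W'[OF inV[OF eG u(1)]] by (simp add: crosses_pair)
    then obtain d where d: "d \<in> F" "d \<noteq> {u, s e}" "crosses d W'"
      using F(3) both[OF e u(1)] unfolding bridgeless_def by blast
    obtain w f where wf: "d = {w, s f}" "f \<in> edges G" "w \<in> f"
      using FE[OF d(1)] by blast
    have wW: "w \<in> W" "\<not> f \<subseteq> W"
      using d(3) wf s_W'[OF wf(2)] v_W'[OF inV[OF wf(2,3)]] by (auto simp: crosses_pair)
    have "f \<noteq> e"
    proof
      assume "f = e"
      then have "w \<noteq> u" using d(2) wf(1) by blast
      moreover obtain a b where "e = {a, b}"
        using wf_graph_edgeE[OF assms(1) eG] by blast
      ultimately show False
        using wW u wf(3) \<open>f = e\<close> by auto
    qed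
    moreover have "f \<in> C"
      using wf d(1) by (auto simp: C_def)
    moreover have "crosses f W"
      using wW wf(3) by (auto simp: crosses_def)
    ultimately show "\<exists>e'\<in>C. e' \<noteq> e \<and> crosses e' W" by blast
  qed
  moreover have "C \<subseteq> edges G" by (auto simp: C_def)
  moreover have "C \<noteq> {}"
  proof -
    obtain d where d: "d \<in> F" using F(2) by blast
    obtain u e where "d = {u, s e}" "e \<in> edges G" "u \<in> e"
      using FE[OF d] by blast
    with d have "e \<in> C" by (auto simp: C_def)
    then show ?thesis by blast
  qed
  ultimately have "g \<le> card (\<Union>C)"
    using assms(3) unfolding girth_at_least_def by blast
  moreover have "\<Union>C \<subseteq> X \<inter> verts G"
  proof
    fix v assume "v \<in> \<Union>C"
    then obtain e where e: "e \<in> C" "v \<in> e" by blast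
    then have "v \<in> verts G" using inV by (auto simp: C_def)
    moreover have "v \<in> X" using FE[OF both[OF e]] by blast
    ultimately show "v \<in> X \<inter> verts G" by blast
  qed
  then have "card (\<Union>C) \<le> card (X \<inter> verts G)"
    using wf_graph_finite_verts[OF assms(1)] by (intro card_mono) auto
  ultimately show ?thesis by linarith
qed

section \<open>Packing and covering numbers\<close>

lemma nu_one_subdivision_le:
  assumes "wf_graph H" "has_cycle H"
    and "wf_graph G" "subdividing s G" "girth_at_least g (edges G)"
  shows "nu H (one_subdivision s G) * g \<le> card (verts G)"
proof -
  let ?G = "one_subdivision s G"
  let ?fam = "\<lambda>\<X>. pairwise disjnt \<X> \<and> (\<forall>X\<in>\<X>. induced_subdiv H ?G X)"
  have fin: "finite (verts ?G)"
    by (rule wf_graph_finite_verts[OF wf_one_subdivision[OF assms(3,4)]])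
  have finV: "finite (verts G)"
    by (rule wf_graph_finite_verts[OF assms(3)])
  have sub: "\<X> \<subseteq> Pow (verts ?G)" if "?fam \<X>" for \<X>
    using that by (auto simp: induced_subdiv_def)
  \<comment> \<open>Finiteness and nonemptiness ensure that the \<open>Max\<close> in
    \<open>nu\<close> is attained by an actual packing.\<close>
  have "{card \<X> | \<X>. ?fam \<X>} \<subseteq> card ` Pow (Pow (verts ?G))"
    using sub by blast
  then have "finite {card \<X> | \<X>. ?fam \<X>}"
    using fin by (meson finite_Pow_iff finite_imageI finite_subset)
  moreover have "?fam {}" by simp
  then have "{card \<X> | \<X>. ?fam \<X>} \<noteq> {}" by blast
  ultimately have "nu H ?G \<in> {card \<X> | \<X>. ?fam \<X>}"
    unfolding nu_def by (rule Max_in)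
  then obtain \<X> where \<X>: "nu H ?G = card \<X>" "?fam \<X>" by blast
  have fin\<X>: "finite \<X>"
    using sub[OF \<X>(2)] fin by (meson finite_Pow_iff finite_subset)
  have large: "g \<le> card (X \<inter> verts G)" if "X \<in> \<X>" for X
  proof -
    have X: "X \<subseteq> verts ?G" "subdivision_of H (induced ?G X)"
      using \<X>(2) that by (auto simp: induced_subdiv_def)
    from subdivision_of_bridgeless[OF X(2) assms(1,2)] show ?thesis
      using girth_one_subdivision[OF assms(3-5) X(1)] by blast
  qed
  have "card \<X> * g \<le> (\<Sum>X\<in>\<X>. card (X \<inter> verts G))"
    using sum_bounded_below[of \<X> g "\<lambda>X. card (X \<inter> verts G)"] large by simp
  also have "\<dots> = card (\<Union>X\<in>\<X>. X \<inter> verts G)"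
    using fin\<X> finV \<X>(2)
    by (intro card_UN_disjoint[symmetric]) (auto simp: pairwise_def disjnt_def)
  also have "\<dots> \<le> card (verts G)"
    using finV by (intro card_mono) auto
  finally show ?thesis using \<X>(1) by simp
qed

text \<open>A deleted original vertex destroys at most \<open>d\<close> edges of \<open>G\<close>, a
  deleted midpoint only one. After \<open>t\<close> deletions at most \<open>d * t\<close> edges are
  gone, and the surviving graph is still dense enough to contain a subdivision \<open>S\<close>,
  whose one-subdivision is induced in the host.\<close>

lemma induced_subdivision_avoiding:
  assumes "wf_graph H" "wf_graph G" "subdividing s G"
    and deg: "\<And>v. card {e \<in> edges G. v \<in> e} \<le> d" and "1 \<le> d"
    and dense: "2 ^ card (edges H) * Suc (card (verts H)) * card (verts G) + d * t \<le> card (edges G)"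
    and "t < card (verts G)" "finite X" "card X \<le> t"
  shows "\<exists>Y. Y \<inter> X = {} \<and> induced_subdiv H (one_subdivision s G) Y"
proof -
  let ?c = "2 ^ card (edges H) * Suc (card (verts H))"
  define E where "E = {e \<in> edges G. e \<inter> X = {} \<and> s e \<notin> X}"
  define G1 where "G1 = (verts G - X, E)"
  have finE: "finite (edges G)" and finV: "finite (verts G)"
    using wf_graph_finite_edges[OF assms(2)] wf_graph_finite_verts[OF assms(2)] by auto
  have hit: "card {e \<in> edges G. x \<in> e \<or> s e = x} \<le> d" for x
  proof (cases "\<exists>e\<in>edges G. s e = x")
    case True
    then obtain e where e: "e \<in> edges G" "s e = x" by blast
    have "x \<notin> verts G"
      using e assms(3) by (auto simp: subdividing_def)
    then have "x \<notin> e'" if "e' \<in> edges G" for e'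
      using that wf_graph_edge_subset[OF assms(2)] by blast
    moreover have "e' = e" if "e' \<in> edges G" "s e' = x" for e'
      using that e assms(3) by (simp add: subdividing_def inj_on_def)
    ultimately have "{e \<in> edges G. x \<in> e \<or> s e = x} \<subseteq> {e}"
      by blast
    then have "card {e \<in> edges G. x \<in> e \<or> s e = x} \<le> card {e}"
      by (rule card_mono[rotated]) simp
    then show ?thesis
      using assms(5) by simp
  next
    case False
    then have "{e \<in> edges G. x \<in> e \<or> s e = x} = {e \<in> edges G. x \<in> e}" by blast
    then show ?thesis using deg by simp
  qed
  have "edges G - E \<subseteq> (\<Union>x\<in>X. {e \<in> edges G. x \<in> e \<or> s e = x})"
    by (auto simp: E_def)
  then have "card (edges G - E) \<le> card (\<Union>x\<in>X. {e \<in> edges G. x \<in> e \<or> s e = x})"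
    using assms(8) finE by (intro card_mono) auto
  also have "\<dots> \<le> (\<Sum>x\<in>X. card {e \<in> edges G. x \<in> e \<or> s e = x})"
    using assms(8) by (rule card_UN_le)
  also have "\<dots> \<le> d * card X"
    using sum_bounded_above[of X "\<lambda>x. card {e \<in> edges G. x \<in> e \<or> s e = x}" d] hit
    by (simp add: mult.commute)
  also have "\<dots> \<le> d * t"
    using assms(9) by simp
  finally have "card (edges G - E) \<le> d * t" .
  moreover have "card (edges G) = card E + card (edges G - E)"
    using finE card_Diff_subset[of E "edges G"] card_mono[of "edges G" E]
    by (auto simp: E_def finite_subset)
  ultimately have "?c * card (verts G) \<le> card E"
    using dense by linarith
  moreover have "?c * card (verts G - X) \<le> ?c * card (verts G)"
    using finV by (intro mult_left_mono card_mono) auto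
  ultimately have "?c * card (verts G1) \<le> card (edges G1)"
    unfolding G1_def verts_Pair edges_Pair by linarith
  moreover have "verts G1 \<noteq> {}"
  proof
    assume "verts G1 = {}"
    then have "card (verts G) \<le> card X"
      using assms(8) by (intro card_mono) (auto simp: G1_def)
    then show False using assms(7,9) by simp
  qed
  moreover have "wf_graph G1"
    unfolding G1_def using wf_graph_edge_subset[OF assms(2)]
    by (intro wf_graph_subgraph[OF assms(2)]) (auto simp: E_def)
  moreover have "wf_graph (verts H, edges H)"
    using assms(1) by (simp add: verts_def edges_def)
  ultimately obtain S where S: "verts S \<subseteq> verts G1" "edges S \<subseteq> edges G1"
      "subdivision_of (verts H, edges H) S"
    using dense_graph_contains_subdivision[OF wf_graph_finite_edges[OF assms(1)]] by blast
  have SG: "verts S \<subseteq> verts G" "edges S \<subseteq> edges G"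
    using S(1,2) by (auto simp: G1_def E_def)
  have "subdivision_of H (one_subdivision s S)"
    using subdivision_of_one_subdivision[OF S(3) subdividing_subgraph[OF assms(3) SG]]
    by (simp add: verts_def edges_def)
  then have "induced_subdiv H (one_subdivision s G) (verts S \<union> s ` edges S)"
    unfolding induced_subdiv_def
      induced_one_subdivision[OF assms(2,3) SG subdivision_of_wf[OF S(3)]]
    using SG by (auto simp: one_subdivision_def)
  moreover have "(verts S \<union> s ` edges S) \<inter> X = {}"
    using S(1,2) by (auto simp: G1_def E_def)
  ultimately show ?thesis by blast
qed

lemma tau_greater:
  assumes "wf_graph H" "has_cycle H" "wf_graph G"
    and "\<And>X. X \<subseteq> verts G \<Longrightarrow> card X \<le> t \<Longrightarrow> \<exists>Y. Y \<inter> X = {} \<and> induced_subdiv H G Y"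
  shows "t < tau H G"
proof -
  let ?hit = "\<lambda>X. X \<subseteq> verts G \<and> \<not> (\<exists>Y. Y \<inter> X = {} \<and> induced_subdiv H G Y)"
  \<comment> \<open>Makes the \<open>Min\<close> in \<open>tau\<close> range over a nonempty set.
    Only the empty set avoids all vertices, and it induces no subdivision of \<open>H\<close>, which
    has an edge.\<close>
  have "?hit (verts G)"
  proof (intro conjI notI order_refl)
    assume "\<exists>Y. Y \<inter> verts G = {} \<and> induced_subdiv H G Y"
    then have sub: "subdivision_of H (induced G {})"
      unfolding induced_subdiv_def by (metis inf.absorb_iff1)
    obtain F where F: "F \<subseteq> edges (induced G {})" "F \<noteq> {}"
      using subdivision_of_bridgeless[OF sub assms(1,2)] by blast
    then have "{} \<in> edges G"
      by (auto simp: induced_def)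
    then show False
      using wf_graph_edgeE[OF assms(3)] by blast
  qed
  then have "{card X | X. ?hit X} \<noteq> {}" by blast
  moreover have "{card X | X. ?hit X} \<subseteq> card ` Pow (verts G)" by blast
  then have "finite {card X | X. ?hit X}"
    using wf_graph_finite_verts[OF assms(3)] by (meson finite_Pow_iff finite_imageI finite_subset)
  ultimately have "tau H G \<in> {card X | X. ?hit X}"
    unfolding tau_def by (intro Min_in)
  then obtain X where "tau H G = card X" "?hit X" by blast
  then show ?thesis
    using assms(4)[of X] by (metis not_le)
qed

section \<open>Choice of the parameters and the final estimate\<close>

theorem girth_graphs_packing_covering:
  fixes H :: "'a graph"
  assumes "wf_graph H" "has_cycle H"
  obtains b :: nat where "2 \<le> b"
    and "\<And>g. 1 \<le> g \<Longrightarrow> \<exists>G :: nat graph. wf_graph G \<and> nu H G * g \<le> 2 * b ^ g \<and> b ^ g \<le> 4 * tau H G"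
proof
  define c where "c = 2 ^ card (edges H) * Suc (card (verts H))"
  \<comment> \<open>The construction yields at least \<open>d * n / 4 = 2 * c * n\<close> edges, and
    deleting \<open>n div 8\<close> vertices destroys at most \<open>d * n / 8 = c * n\<close> of
    them; the remaining \<open>c * n\<close> edges are what the subdivision theorem asks
    for.\<close>
  define d where "d = 8 * c"
  have c: "1 \<le> c" by (simp add: c_def Suc_le_eq)
  show "2 \<le> Suc d" using c by (simp add: d_def)
  fix g :: nat assume g: "1 \<le> g"
  \<comment> \<open>The smallest order that \<open>dense_girth_graph_exists\<close> admits, so that
    \<open>g\<close> is as large as possible relative to \<open>n\<close>.\<close>
  define n where "n = 2 * Suc d ^ g"
  obtain E where E: "wf_graph ({..<n}, E)" "\<And>v. card {e \<in> E. v \<in> e} \<le> d" "girth_at_least g E"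
      "d * n \<le> 4 * card E"
    using dense_girth_graph_exists[of "{..<n}" g d] g by (auto simp: n_def)
  let ?G = "({..<n}, E)"
  \<comment> \<open>\<open>set_encode\<close> is injective on finite sets of naturals, and the shift
    by \<open>n\<close> moves the codes beyond the vertices.\<close>
  define s where "s e = n + set_encode e" for e
  have "finite e" if "e \<in> E" for e
    using card_edge[OF E(1), of e] that by (simp add: card_ge_0_finite)
  then have "inj_on set_encode E"
    using inj_on_set_encode by (meson inj_on_subset mem_Collect_eq subsetI)
  then have s: "subdividing s ?G"
    by (auto simp: subdividing_def s_def inj_on_def)
  let ?S = "one_subdivision s ?G"
  have wfS: "wf_graph ?S" by (rule wf_one_subdivision[OF E(1) s])
  have "nu H ?S * g \<le> n"
    using nu_one_subdivision_le[OF assms E(1) s] E(3) by simp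
  moreover have "n div 8 < tau H ?S"
  proof (rule tau_greater[OF assms wfS])
    fix X assume X: "X \<subseteq> verts ?S" "card X \<le> n div 8"
    have finX: "finite X"
      using X(1) wf_graph_finite_verts[OF wfS] finite_subset by blast
    have "n > 0" by (simp add: n_def)
    then have n8: "n div 8 < n" by simp
    have "d * (n div 8) \<le> c * n"
      by (simp add: d_def)
    moreover have "2 * (c * n) \<le> card E"
      using E(4) by (simp add: d_def)
    ultimately have "c * n + d * (n div 8) \<le> card E" by linarith
    then show "\<exists>Y. Y \<inter> X = {} \<and> induced_subdiv H ?S Y"
      using E(2) c n8 finX X(2)
      by (intro induced_subdivision_avoiding[OF assms(1) E(1) s, of d "n div 8"])
        (auto simp: d_def c_def)
  qed
  then have "n \<le> 8 * tau H ?S" by linarith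
  ultimately show "\<exists>G :: nat graph. wf_graph G \<and> nu H G * g \<le> 2 * Suc d ^ g \<and> Suc d ^ g \<le> 4 * tau H G"
    using wfS by (intro exI[of _ ?S]) (simp add: n_def)
qed

theorem mainTheorem9:
  fixes H :: "'a graph"
  assumes "wf_graph H" and "has_cycle H" and "\<forall>v\<in>verts H. degree H v \<le> 3"
  shows "\<not> (\<exists>f :: nat \<Rightarrow> real. f \<in> o(\<lambda>k. real k * ln (real k)) \<and>
            (\<forall>G :: nat graph. wf_graph G \<longrightarrow> real (tau H G) \<le> f (nu H G)))"
proof
  assume "\<exists>f :: nat \<Rightarrow> real. f \<in> o(\<lambda>k. real k * ln (real k)) \<and>
            (\<forall>G :: nat graph. wf_graph G \<longrightarrow> real (tau H G) \<le> f (nu H G))"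
  then obtain f :: "nat \<Rightarrow> real" where f: "f \<in> o(\<lambda>k. real k * ln (real k))"
    and bound: "\<And>G :: nat graph. wf_graph G \<Longrightarrow> real (tau H G) \<le> f (nu H G)"
    by blast
  obtain b :: nat where b: "2 \<le> b"
    and graphs: "\<And>g. 1 \<le> g \<Longrightarrow>
      \<exists>G :: nat graph. wf_graph G \<and> nu H G * g \<le> 2 * b ^ g \<and> b ^ g \<le> 4 * tau H G"
    using girth_graphs_packing_covering[OF assms(1,2)] by blast
  \<comment> \<open>Chosen so that the bound \<open>4 * b ^ g * ln b\<close> on
    \<open>k * ln k\<close> gives \<open>f k\<close> at most \<open>b ^ g / 8\<close>, below the
    value \<open>b ^ g / 4\<close> forced by the covering number.\<close>
  define \<epsilon> where "\<epsilon> = 1 / (32 * ln (real b))"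
  have lnb: "0 < ln (real b)" using b by simp
  then have "0 < \<epsilon>" by (simp add: \<epsilon>_def)
  from landau_o.smallD[OF f this] obtain K where
    K: "\<And>k. K \<le> k \<Longrightarrow> \<bar>f k\<bar> \<le> \<epsilon> * \<bar>real k * ln (real k)\<bar>"
    by (auto simp: eventually_at_top_linorder)
  \<comment> \<open>Bounds \<open>f\<close> on the finitely many \<open>k\<close> below
    \<open>K\<close>, where the little-o estimate says nothing. Taking \<open>b ^ g\<close> above
    \<open>4 * M\<close> rules these \<open>k\<close> out, in place of a lower bound on
    \<open>nu\<close>.\<close>
  define M where "M = (\<Sum>k<K. \<bar>f k\<bar>)"
  obtain g0 :: nat where g0: "4 * M < real b ^ g0"
    using real_arch_pow[of "real b" "4 * M"] b by auto
  define g where "g = max 1 g0"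
  have g: "1 \<le> g" by (simp add: g_def)
  have gM: "4 * M < real b ^ g"
  proof -
    have "real b ^ g0 \<le> real b ^ g"
      using b by (intro power_increasing) (auto simp: g_def)
    then show ?thesis using g0 by linarith
  qed
  obtain G :: "nat graph" where G: "wf_graph G" "nu H G * g \<le> 2 * b ^ g" "b ^ g \<le> 4 * tau H G"
    using graphs[OF g] by blast
  define k where "k = nu H G"
  have "real (b ^ g) \<le> real (4 * tau H G)"
    using G(3) by (rule of_nat_mono)
  then have low: "real b ^ g \<le> 4 * f k"
    using bound[OF G(1)] by (simp add: k_def)
  show False
  proof (cases "k < K")
    case True
    then have "\<bar>f k\<bar> \<le> M"
      unfolding M_def by (intro member_le_sum) auto
    then show False using low gM by linarith
  next
    case False
    have kg: "real k * real g \<le> 2 * real b ^ g"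
      using of_nat_mono[OF G(2), where ?'a = real] by (simp add: k_def)
    have pos: "0 < real b ^ g" using b by simp
    \<comment> \<open>The factor \<open>g\<close> cancels: \<open>k * g\<close> is at most
      \<open>2 * b ^ g\<close>, while \<open>ln k\<close> is at most \<open>(g + 1) * ln b\<close>,
      hence at most \<open>2 * g * ln b\<close>.\<close>
    have upper: "real k * ln (real k) \<le> 4 * real b ^ g * ln (real b)"
    proof (cases "k = 0")
      case False
      have "real k * 1 \<le> real k * real g"
        using g by (intro mult_left_mono) auto
      then have "real k \<le> 2 * real b ^ g" using kg by linarith
      \<comment> \<open>The factor 2 is absorbed into one more power of \<open>b\<close>, so that
        the logarithm is an exact multiple of \<open>ln b\<close>.\<close>
      also have "\<dots> \<le> real b * real b ^ g"
        using b by (intro mult_right_mono) auto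
      finally have "ln (real k) \<le> ln (real b ^ Suc g)"
        using False by (intro ln_mono) auto
      also have "\<dots> = real (Suc g) * ln (real b)"
        using b by (simp add: ln_realpow del: power_Suc)
      also have "\<dots> \<le> (2 * real g) * ln (real b)"
        using g lnb by (intro mult_right_mono) auto
      finally have "real k * ln (real k) \<le> real k * ((2 * real g) * ln (real b))"
        by (intro mult_left_mono) auto
      also have "\<dots> = 2 * (real k * real g) * ln (real b)" by simp
      also have "\<dots> \<le> 2 * (2 * real b ^ g) * ln (real b)"
        using kg lnb by (intro mult_right_mono mult_left_mono) auto
      finally show ?thesis by simp
    qed (use lnb pos in simp)
    have "0 \<le> real k * ln (real k)"
      by (cases "k = 0") auto
    then have "\<bar>f k\<bar> \<le> \<epsilon> * (real k * ln (real k))"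
      using K[of k] False by simp
    also have "\<dots> \<le> \<epsilon> * (4 * real b ^ g * ln (real b))"
      using upper \<open>0 < \<epsilon>\<close> by (intro mult_left_mono) auto
    also have "\<dots> = real b ^ g / 8"
      using lnb by (simp add: \<epsilon>_def field_simps)
    finally show False using low pos by linarith
  qed
qed

end
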